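(* Let $R$ be a commutative ring with unity with no nontrivial idempotents such that $\mathrm{Cl}(R)$ is not a complete graph. Then $\mathrm{Cl}(R)_{SR}=2K_{|U(R)|}$ (the disjoint union of two complete graphs on $|U(R)|$ vertices each). Moreover, $V(\mathrm{Cl}(R))=V(\mathrm{Cl}(R)_{SR})$.
   Context: All rings are commutative with unity. $U(R)$ is the set of units, $\mathrm{Id}(R)$ the set of idempotents. The clean graph $\mathrm{Cl}(R)$ has vertex set $\{(e,u): e\in\mathrm{Id}(R), u\in U(R)\}$, two distinct vertices $(e,u),(f,v)$ being adjacent iff $ef=0$ or $uv=1$. In a connected graph $\Gamma$ with distance $d$ and neighbourhoods $N(x)$, $x$ is maximally distant from $y$ if $d(y,w)\le d(x,y)$ for all $w\in N(x)$, and $x,y$ are mutually maximally distant (MMD) if each is maximally distant from the other. The strong resolving graph $\Gamma_{SR}$ has as vertex set the set of vertices that are MMD with some vertex, two vertices being adjacent iff they are MMD in $\Gamma$. *)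

theory Defs
  imports "HOL-Algebra.Ring" "Graph_Theory.Graph_Theory"
begin

text \<open>
  Simple undirected graphs, possibly infinite, are represented as symmetric loop-free
  pair digraphs: an edge is a pair of opposite arcs.
\<close>

definition is_complete_graph :: "'v pair_pre_digraph \<Rightarrow> bool" where
  "is_complete_graph G \<longleftrightarrow> (\<forall>x\<in>pverts G. \<forall>y\<in>pverts G. x \<noteq> y \<longrightarrow> (x, y) \<in> parcs G)"

text \<open>
  The library predicate \<^const>\<open>complete_digraph\<close> requires finiteness; here \<open>A\<close> may have any
  cardinality.
\<close>

definition complete_graph_on :: "'v set \<Rightarrow> 'v pair_pre_digraph" where
  "complete_graph_on A = \<lparr> pverts = A, parcs = {(x, y). x \<in> A \<and> y \<in> A \<and> x \<noteq> y} \<rparr>"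

definition disjoint_graph_union ::
    "'v pair_pre_digraph \<Rightarrow> 'w pair_pre_digraph \<Rightarrow> ('v + 'w) pair_pre_digraph" where
  "disjoint_graph_union G H =
     \<lparr> pverts = pverts G <+> pverts H,
       parcs = map_prod Inl Inl ` parcs G \<union> map_prod Inr Inr ` parcs H \<rparr>"

text \<open>With unit weights the cost of a walk is its length.\<close>

definition graph_dist :: "'v pair_pre_digraph \<Rightarrow> 'v \<Rightarrow> 'v \<Rightarrow> ereal" where
  "graph_dist G x y = wf_digraph.\<mu> (with_proj G) (\<lambda>_. 1) x y"

definition neighbourhood :: "'v pair_pre_digraph \<Rightarrow> 'v \<Rightarrow> 'v set" where
  "neighbourhood G x = {w \<in> pverts G. (x, w) \<in> parcs G}"

definition maximally_distant :: "'v pair_pre_digraph \<Rightarrow> 'v \<Rightarrow> 'v \<Rightarrow> bool" where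
  "maximally_distant G x y \<longleftrightarrow> (\<forall>w\<in>neighbourhood G x. graph_dist G y w \<le> graph_dist G x y)"

definition MMD :: "'v pair_pre_digraph \<Rightarrow> 'v \<Rightarrow> 'v \<Rightarrow> bool" where
  "MMD G x y \<longleftrightarrow> maximally_distant G x y \<and> maximally_distant G y x"

definition strong_resolving_graph :: "'v pair_pre_digraph \<Rightarrow> 'v pair_pre_digraph" where
  "strong_resolving_graph G =
     (let V = {x \<in> pverts G. \<exists>y\<in>pverts G. MMD G x y}
      in \<lparr> pverts = V, parcs = {(x, y). x \<in> V \<and> y \<in> V \<and> x \<noteq> y \<and> MMD G x y} \<rparr>)"

definition ring_idempotents :: "('a, 'b) ring_scheme \<Rightarrow> 'a set" where
  "ring_idempotents R = {e \<in> carrier R. e \<otimes>\<^bsub>R\<^esub> e = e}"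

definition clean_graph :: "('a, 'b) ring_scheme \<Rightarrow> ('a \<times> 'a) pair_pre_digraph" where
  "clean_graph R =
     (let V = ring_idempotents R \<times> Units R
      in \<lparr> pverts = V,
           parcs = {((e, u), (f, v)). (e, u) \<in> V \<and> (f, v) \<in> V \<and> (e, u) \<noteq> (f, v) \<and>
                      (e \<otimes>\<^bsub>R\<^esub> f = \<zero>\<^bsub>R\<^esub> \<or> u \<otimes>\<^bsub>R\<^esub> v = \<one>\<^bsub>R\<^esub>)} \<rparr>)"

end

theory Submission
  imports Defs
begin

text \<open>
  A vertex \<open>(\<zero>, u)\<close> is adjacent to every other vertex, so \<open>Cl(R)\<close> has diameter at most two. In a
  graph of diameter at most two, distinct vertices are mutually maximally distant iff they are
  non-adjacent or have the same closed neighbourhood. The vertices \<open>(\<zero>, u)\<close> all have the same closed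
  neighbourhood; \<open>(\<one>, u)\<close> and \<open>(\<one>, v)\<close> are non-adjacent unless \<open>u \<otimes> v = \<one>\<close>, in which case their
  closed neighbourhoods agree; and non-completeness means that no \<open>(\<one>, v)\<close> is adjacent to all
  other vertices, so it is never mutually maximally distant from a vertex \<open>(\<zero>, u)\<close>.
\<close>

section \<open>Isomorphisms induced by vertex maps\<close>

lemma digraph_iso_with_projI:
  assumes wf: "pair_wf_digraph G"
    and inj: "inj_on f (pverts G)"
    and verts: "pverts H = f ` pverts G"
    and arcs: "parcs H = map_prod f f ` parcs G"
  shows "digraph_iso (with_proj G) (with_proj H)"
proof -
  interpret pair_wf_digraph G by (rule wf)
  let ?h = "\<lparr>iso_verts = f, iso_arcs = map_prod f f, iso_head = snd, iso_tail = fst\<rparr>"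
  \<comment> \<open>Arcs are pairs of vertices, so injectivity of \<open>f\<close> on the vertices
    carries over to the arc map \<open>map_prod f f\<close>.\<close>
  have "parcs G \<subseteq> pverts G \<times> pverts G"
    by (auto dest: in_arcsD1 in_arcsD2)
  with inj have "inj_on (map_prod f f) (parcs G)"
    by (blast intro: inj_on_subset map_prod_inj_on)
  with inj wf_digraph_axioms have "pre_digraph.digraph_isomorphism (with_proj G) ?h"
    by (simp add: pre_digraph.digraph_isomorphism_def)
  moreover have "with_proj H = app_iso ?h (with_proj G)"
    by (simp add: app_iso_def with_proj_def verts arcs)
  ultimately show ?thesis
    unfolding digraph_iso_def by blast
qed

lemma complete_graph_on_simps [simp]:
  "pverts (complete_graph_on A) = A"
  "parcs (complete_graph_on A) = {(x, y). x \<in> A \<and> y \<in> A \<and> x \<noteq> y}"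
  by (simp_all add: complete_graph_on_def)

lemma disjoint_graph_union_simps [simp]:
  "pverts (disjoint_graph_union G H) = pverts G <+> pverts H"
  "parcs (disjoint_graph_union G H) = map_prod Inl Inl ` parcs G \<union> map_prod Inr Inr ` parcs H"
  by (simp_all add: disjoint_graph_union_def)

lemma pair_wf_digraph_strong_resolving_graph: "pair_wf_digraph (strong_resolving_graph G)"
  by unfold_locales (auto simp: strong_resolving_graph_def Let_def)

section \<open>Distances zero, one and two\<close>

context pair_wf_digraph
begin

lemma awalk_cost_unit_weights: "awalk_cost (\<lambda>_. 1) p = real (length p)"
  by (induct p) auto

lemma graph_dist_le_length:
  assumes "awalk x p y"
  shows "graph_dist G x y \<le> ereal (real (length p))"
  using min_cost_le_walk_cost[OF assms, of "\<lambda>_. 1"]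
  by (simp add: graph_dist_def awalk_cost_unit_weights)

text \<open>Lower bounds on walk lengths pass to the infimum that defines \<open>\<mu>\<close>;
  without any walk that infimum is infinite.\<close>

lemma le_graph_dist:
  assumes "\<And>p. awalk x p y \<Longrightarrow> n \<le> length p"
  shows "ereal (real n) \<le> graph_dist G x y"
  unfolding graph_dist_def \<mu>_def
  by (rule INF_greatest) (auto simp: awalk_cost_unit_weights dest: assms)

lemma graph_dist_refl:
  assumes "x \<in> pverts G"
  shows "graph_dist G x x = 0"
proof (rule antisym)
  show "graph_dist G x x \<le> 0"
    using graph_dist_le_length[of x "[]" x] assms by (simp add: awalk_Nil_iff zero_ereal_def)
  show "0 \<le> graph_dist G x x"
    using le_graph_dist[of x x 0] by (simp add: zero_ereal_def)
qed

lemma graph_dist_arc: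
  assumes "(x, y) \<in> parcs G" "x \<noteq> y"
  shows "graph_dist G x y = 1"
proof (rule antisym)
  show "graph_dist G x y \<le> 1"
    using graph_dist_le_length[of x "[(x, y)]" y] assms
    by (auto simp: awalk_simps one_ereal_def dest: in_arcsD1 in_arcsD2)
  have "1 \<le> length p" if "awalk x p y" for p
    using that assms(2) by (cases p) (auto simp: awalk_simps)
  then show "1 \<le> graph_dist G x y"
    using le_graph_dist[of x y 1] by (simp add: one_ereal_def)
qed

lemma graph_dist_common_neighbour:
  assumes "(x, c) \<in> parcs G" "(c, y) \<in> parcs G" "x \<noteq> y" "(x, y) \<notin> parcs G"
  shows "graph_dist G x y = 2"
proof (rule antisym)
  have two: "(2::ereal) = ereal (real 2)"
    by simp
  show "graph_dist G x y \<le> 2"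
    using graph_dist_le_length[of x "[(x, c), (c, y)]" y] assms
    by (auto simp: awalk_simps dest: in_arcsD1 in_arcsD2)
  \<comment> \<open>The empty walk would give \<open>x = y\<close>, and a walk of length one would
    be an arc from \<open>x\<close> to \<open>y\<close>.\<close>
  have "2 \<le> length p" if "awalk x p y" for p
  proof (cases p)
    case Nil
    with that assms(3) show ?thesis by (simp add: awalk_simps)
  next
    case (Cons a q)
    with that assms(4) show ?thesis by (cases q) (auto simp: awalk_simps)
  qed
  then show "2 \<le> graph_dist G x y"
    unfolding two by (rule le_graph_dist)
qed

end

section \<open>Graphs with a vertex adjacent to all others\<close>

locale dominated_graph = pair_bidirected_digraph +
  fixes c
  assumes dominating: "x \<in> pverts G \<Longrightarrow> x \<noteq> c \<Longrightarrow> (x, c) \<in> parcs G"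
begin

lemma parcs_commute: "(x, y) \<in> parcs G \<longleftrightarrow> (y, x) \<in> parcs G"
  using pair_sym_arcs by (auto simp: symmetric_def dest: symD)

lemma graph_dist_eq:
  assumes "x \<in> pverts G" "y \<in> pverts G"
  shows "graph_dist G x y = (if x = y then 0 else if (x, y) \<in> parcs G then 1 else 2)"
proof -
  \<comment> \<open>Neither vertex is \<open>c\<close>, since \<open>c\<close> is adjacent to every
    other vertex; hence \<open>c\<close> is a common neighbour.\<close>
  have "graph_dist G x y = 2" if "x \<noteq> y" "(x, y) \<notin> parcs G"
    using that assms dominating parcs_commute
    by (metis graph_dist_common_neighbour)
  then show ?thesis
    using assms by (simp add: graph_dist_refl graph_dist_arc)
qed

text \<open>Non-adjacent vertices already attain the largest possible distance two. For adjacent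
  ones the bound is one, which confines the neighbours of \<open>x\<close> to the closed
  neighbourhood of \<open>y\<close>.\<close>

lemma maximally_distant_iff:
  assumes "x \<in> pverts G" "y \<in> pverts G" "x \<noteq> y"
  shows "maximally_distant G x y \<longleftrightarrow>
    ((x, y) \<in> parcs G \<longrightarrow> (\<forall>w. (x, w) \<in> parcs G \<longrightarrow> w = y \<or> (y, w) \<in> parcs G))"
proof -
  have "w \<in> neighbourhood G x \<longleftrightarrow> (x, w) \<in> parcs G" for w
    by (auto simp: neighbourhood_def dest: in_arcsD2)
  moreover have "graph_dist G y w \<le> graph_dist G x y \<longleftrightarrow>
      ((x, y) \<in> parcs G \<longrightarrow> w = y \<or> (y, w) \<in> parcs G)" if "(x, w) \<in> parcs G" for w
    using that assms in_arcsD2[OF that] by (auto simp: graph_dist_eq)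
  ultimately show ?thesis
    unfolding maximally_distant_def by blast
qed

text \<open>The two one-sided conditions are opposite inclusions of neighbourhoods. The ends
  \<open>x\<close> and \<open>y\<close> are left out of the comparison because there are no
  loops.\<close>

lemma MMD_iff:
  assumes "x \<in> pverts G" "y \<in> pverts G" "x \<noteq> y"
  shows "MMD G x y \<longleftrightarrow>
    ((x, y) \<in> parcs G \<longrightarrow>
      (\<forall>w. w \<noteq> x \<longrightarrow> w \<noteq> y \<longrightarrow> (x, w) \<in> parcs G \<longleftrightarrow> (y, w) \<in> parcs G))"
  using assms parcs_commute[of x y] pair_no_loops
  unfolding MMD_def by (fastforce simp: maximally_distant_iff)

end

section \<open>The clean graph\<close>

context cring
begin

lemma idempotents_eq:
  assumes "ring_idempotents R \<subseteq> {\<zero>, \<one>}"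
  shows "ring_idempotents R = {\<zero>, \<one>}"
  using assms by (auto simp: ring_idempotents_def)

lemma pverts_clean_graph: "pverts (clean_graph R) = ring_idempotents R \<times> Units R"
  by (simp add: clean_graph_def Let_def)

lemma clean_graph_arc_iff:
  "((e, u), (f, v)) \<in> parcs (clean_graph R) \<longleftrightarrow>
    e \<in> ring_idempotents R \<and> f \<in> ring_idempotents R \<and> u \<in> Units R \<and> v \<in> Units R \<and>
    (e, u) \<noteq> (f, v) \<and> (e \<otimes> f = \<zero> \<or> u \<otimes> v = \<one>)"
  by (auto simp: clean_graph_def Let_def)

lemma clean_graph_arc_commute:
  "((e, u), (f, v)) \<in> parcs (clean_graph R) \<longleftrightarrow> ((f, v), (e, u)) \<in> parcs (clean_graph R)"
  by (auto simp: clean_graph_arc_iff ring_idempotents_def m_comm Units_closed)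

lemma dominated_graph_clean_graph: "dominated_graph (clean_graph R) (\<zero>, \<one>)"
proof
  show "symmetric (with_proj (clean_graph R))"
    using clean_graph_arc_commute by (auto simp: symmetric_def intro!: symI)
qed (auto simp: pverts_clean_graph clean_graph_arc_iff ring_idempotents_def)

lemma incomplete_clean_graphD:
  assumes "ring_idempotents R \<subseteq> {\<zero>, \<one>}" "\<not> is_complete_graph (clean_graph R)"
  shows "\<exists>p\<in>Units R. \<exists>q\<in>Units R. p \<noteq> q \<and> p \<otimes> q \<noteq> \<one>"
proof -
  obtain e u f v where *: "(e, u) \<in> pverts (clean_graph R)" "(f, v) \<in> pverts (clean_graph R)"
      "(e, u) \<noteq> (f, v)" "((e, u), (f, v)) \<notin> parcs (clean_graph R)"
    using assms(2) by (auto simp: is_complete_graph_def)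
  then have "u \<in> Units R" "v \<in> Units R" "e \<otimes> f \<noteq> \<zero>" "u \<otimes> v \<noteq> \<one>"
    by (auto simp: pverts_clean_graph clean_graph_arc_iff)
  \<comment> \<open>A nonzero product of elements of \<open>{\<zero>, \<one>}\<close> forces
    \<open>e = f = \<one>\<close>, so the distinct vertices differ in their units.\<close>
  moreover from this * assms(1) have "u \<noteq> v"
    by (auto simp: pverts_clean_graph idempotents_eq)
  ultimately show ?thesis by blast
qed

text \<open>Otherwise \<open>v\<close> and its inverse would be the only units, and the distinct
  units \<open>p\<close> and \<open>q\<close> would be mutually inverse. This turns a single pair
  \<open>p\<close>, \<open>q\<close> into a witness for every \<open>v\<close>.\<close>

lemma ex_unit_distinct_from_self_and_inverse:
  assumes "p \<in> Units R" "q \<in> Units R" "p \<noteq> q" "p \<otimes> q \<noteq> \<one>" "v \<in> Units R"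
  shows "\<exists>w\<in>Units R. w \<noteq> v \<and> v \<otimes> w \<noteq> \<one>"
proof (rule ccontr)
  assume "\<not> ?thesis"
  then have *: "w = v \<or> v \<otimes> w = \<one>" if "w \<in> Units R" for w
    using that by blast
  have unique: "w = w'" if "w \<in> Units R" "w' \<in> Units R" "v \<otimes> w = \<one>" "v \<otimes> w' = \<one>" for w w'
    using that assms(5) by (metis Units_closed Units_l_cancel)
  show False
    using assms * unique by (metis Units_closed m_comm)
qed

lemma MMD_clean_graph_iff:
  assumes idem: "ring_idempotents R \<subseteq> {\<zero>, \<one>}"
    and incomplete: "\<not> is_complete_graph (clean_graph R)"
    and "x \<in> pverts (clean_graph R)" "y \<in> pverts (clean_graph R)" "x \<noteq> y"
  shows "MMD (clean_graph R) x y \<longleftrightarrow> fst x = fst y"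
proof -
  interpret G: dominated_graph "clean_graph R" "(\<zero>, \<one>)"
    by (rule dominated_graph_clean_graph)
  obtain p q where pq: "p \<in> Units R" "q \<in> Units R" "p \<noteq> q" "p \<otimes> q \<noteq> \<one>"
    using incomplete_clean_graphD[OF idem incomplete] by blast
  \<comment> \<open>If \<open>\<one> = \<zero>\<close>, the carrier is a singleton and cannot
    contain two distinct units.\<close>
  have nontrivial: "\<one> \<noteq> \<zero>"
    using pq by (metis Units_closed one_zeroD singletonD)
  note arc = clean_graph_arc_iff idempotents_eq[OF idem]
  have no_MMD: "\<not> MMD (clean_graph R) (\<zero>, u) (\<one>, v)" if uv: "u \<in> Units R" "v \<in> Units R" for u v
  proof -
    obtain w where "w \<in> Units R" "w \<noteq> v" "v \<otimes> w \<noteq> \<one>"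
      using ex_unit_distinct_from_self_and_inverse[OF pq uv(2)] by blast
    \<comment> \<open>The vertex \<open>(\<one>, w)\<close> separates the closed neighbourhoods of
      the adjacent vertices \<open>(\<zero>, u)\<close> and \<open>(\<one>, v)\<close>.\<close>
    then have "((\<zero>, u), (\<one>, w)) \<in> parcs (clean_graph R)" "((\<one>, v), (\<one>, w)) \<notin> parcs (clean_graph R)"
      "((\<zero>, u), (\<one>, v)) \<in> parcs (clean_graph R)" "(\<one>, w) \<noteq> (\<zero>, u)" "(\<one>, w) \<noteq> (\<one>, v)"
      using uv nontrivial by (auto simp: arc)
    then show ?thesis
      using uv nontrivial G.MMD_iff[of "(\<zero>, u)" "(\<one>, v)"]
      by (auto simp: pverts_clean_graph idempotents_eq[OF idem])
  qed
  have zero_zero: "MMD (clean_graph R) (\<zero>, u) (\<zero>, v)"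
    if "u \<in> Units R" "v \<in> Units R" "u \<noteq> v" for u v
    using that by (subst G.MMD_iff) (auto simp: pverts_clean_graph arc)
  have one_one: "MMD (clean_graph R) (\<one>, u) (\<one>, v)"
    if uv: "u \<in> Units R" "v \<in> Units R" "u \<noteq> v" for u v
  proof -
    \<comment> \<open>By uniqueness of inverses, if the two vertices are adjacent, neither has a
      further neighbour with idempotent \<open>\<one>\<close>; both are adjacent to every
      \<open>(\<zero>, w)\<close>.\<close>
    have eq_inverse: "w = v" if "w \<in> Units R" "u \<otimes> v = \<one>" "u \<otimes> w = \<one>" for w
      using that uv by (metis Units_closed Units_l_cancel)
    have eq_inverse': "w = u" if "w \<in> Units R" "u \<otimes> v = \<one>" "v \<otimes> w = \<one>" for w
      using that uv by (metis Units_closed Units_l_cancel m_comm)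
    show ?thesis
      using uv nontrivial
      by (subst G.MMD_iff)
         (auto simp: pverts_clean_graph arc dest: eq_inverse eq_inverse')
  qed
  have "MMD (clean_graph R) a b \<longleftrightarrow> MMD (clean_graph R) b a" for a b
    by (auto simp: MMD_def)
  then show ?thesis
    using assms(3-5) nontrivial no_MMD zero_zero one_one
    by (auto simp: pverts_clean_graph idempotents_eq[OF idem])
qed

end

theorem theorem3p5:
  fixes R :: "('a, 'b) ring_scheme" (structure)
  assumes "cring R"
    and "ring_idempotents R \<subseteq> {\<zero>, \<one>}"
    and "\<not> is_complete_graph (clean_graph R)"
  shows "digraph_iso
           (with_proj (strong_resolving_graph (clean_graph R)))
           (with_proj (disjoint_graph_union (complete_graph_on (Units R)) (complete_graph_on (Units R))))
       \<and> pverts (clean_graph R) = pverts (strong_resolving_graph (clean_graph R))"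
proof -
  interpret cring R by (rule assms(1))
  let ?C = "clean_graph R" and ?S = "strong_resolving_graph (clean_graph R)"
  note MMD_iff = MMD_clean_graph_iff[OF assms(2,3)]
  obtain p q where pq: "p \<in> Units R" "q \<in> Units R" "p \<noteq> q" "p \<otimes> q \<noteq> \<one>"
    using incomplete_clean_graphD[OF assms(2,3)] by blast
  have nontrivial: "\<one> \<noteq> \<zero>"
    using pq by (metis Units_closed one_zeroD singletonD)
  have pverts_C: "pverts ?C = {\<zero>, \<one>} \<times> Units R"
    by (simp add: pverts_clean_graph idempotents_eq[OF assms(2)])
  have "\<exists>y\<in>pverts ?C. MMD ?C x y" if x: "x \<in> pverts ?C" for x
  proof -
    \<comment> \<open>Since \<open>p\<close> and \<open>q\<close> differ, at least one of them
      differs from \<open>snd x\<close>.\<close>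
    obtain w where "w \<in> Units R" "w \<noteq> snd x"
      using pq by metis
    with x have "(fst x, w) \<in> pverts ?C" "x \<noteq> (fst x, w)"
      by (auto simp: pverts_C)
    with x show ?thesis
      by (metis MMD_iff fst_conv)
  qed
  then have pverts_S: "pverts ?S = pverts ?C"
    by (auto simp: strong_resolving_graph_def Let_def)
  then have parcs_S: "parcs ?S = {(x, y). x \<in> pverts ?C \<and> y \<in> pverts ?C \<and> x \<noteq> y \<and> fst x = fst y}"
    by (auto simp: strong_resolving_graph_def Let_def MMD_iff)
  \<comment> \<open>The idempotent selects the copy of the complete graph, and the unit becomes the
    vertex in that copy.\<close>
  let ?f = "\<lambda>(e, u). if e = \<zero> then Inl u else Inr u"
  have "digraph_iso (with_proj ?S)
      (with_proj (disjoint_graph_union (complete_graph_on (Units R)) (complete_graph_on (Units R))))"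
  proof (rule digraph_iso_with_projI[where f = ?f])
    show "inj_on ?f (pverts ?S)"
      by (auto simp: pverts_S pverts_C inj_on_def)
    \<comment> \<open>Splitting by idempotent makes the case distinction in \<open>?f\<close>
      constant on each piece, so its image can be computed; the arcs are split likewise.\<close>
    have "pverts ?S = Pair \<zero> ` Units R \<union> Pair \<one> ` Units R"
      by (auto simp: pverts_S pverts_C)
    then show "pverts (disjoint_graph_union (complete_graph_on (Units R)) (complete_graph_on (Units R)))
        = ?f ` pverts ?S"
      using nontrivial by (simp add: image_Un image_image Plus_def)
    have "parcs ?S = (\<lambda>(u, v). ((\<zero>, u), (\<zero>, v))) ` {(u, v). u \<in> Units R \<and> v \<in> Units R \<and> u \<noteq> v}
        \<union> (\<lambda>(u, v). ((\<one>, u), (\<one>, v))) ` {(u, v). u \<in> Units R \<and> v \<in> Units R \<and> u \<noteq> v}"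
      by (auto simp: parcs_S pverts_C)
    then show "parcs (disjoint_graph_union (complete_graph_on (Units R)) (complete_graph_on (Units R)))
        = map_prod ?f ?f ` parcs ?S"
      using nontrivial
      by (simp add: image_Un image_image case_prod_beta map_prod_def)
  qed (rule pair_wf_digraph_strong_resolving_graph)
  with pverts_S show ?thesis by simp
qed

end
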